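(* Let $1<p,q<\infty$ and let $a$ and $\omega$ be weight functions on $\mathbb R^n$. Assume that $a$ is a Beurling weight function and that $\omega^{-1/q}\in L^r(\mathbb R^n)$, where $\frac1q+\frac1r=1$. Then the Hardy–Littlewood maximal operator $$M: W(L_a^{p)}(\mathbb R^n),L^q(\mathbb R^n,\omega))\to W(L_a^{p)}(\mathbb R^n),L^q(\mathbb R^n,\omega))$$ is not bounded.
   Context: For a locally integrable $f$ on $\mathbb R^n$, the (centered) Hardy–Littlewood maximal function is $Mf(x)=\sup_{r>0}\frac1{|B_r(x)|}\int_{B_r(x)}|f(y)|\,dy$, where $B_r(x)$ is the open ball of radius $r$ centered at $x$. A weight function on $\mathbb R^n$ is a measurable, locally integrable real-valued function that is positive (it may vanish only on a set of measure zero). A weight $a$ is a Beurling weight function if $a(x+y)\le a(x)a(y)$ and $a(x)\ge1$ for all $x,y\in\mathbb R^n$. For $1<q<\infty$, $\|f\|_{L^q(\mathbb R^n,\omega)}=\left(\int_{\mathbb R^n}|f(x)|^q\omega(x)\,dx\right)^{1/q}$. For $1<p<\infty$ and a weight $a$, the generalized grand Lebesgue space $L_a^{p)}(\mathbb R^n)$ consists of the (classes of) measurable $f$ with $$\|f\|_{L_a^{p)}(\mathbb R^n)}=\sup_{0<\varepsilon\le p-1}\varepsilon\left(\int_{\mathbb R^n}|f(x)|^{p-\varepsilon}a(x)^{\varepsilon/p}\,dx\right)^{1/(p-\varepsilon)}<\infty .$$ Fix a compact set $Q\subset\mathbb R^n$ with nonempty interior. The space $W(L_a^{p)}(\mathbb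 R^n),L^q(\mathbb R^n,\omega))$ consists of all (classes of) measurable $f:\mathbb R^n\to\mathbb C$ such that $f\chi_K\in L_a^{p)}(\mathbb R^n)$ for every compact $K\subset\mathbb R^n$ and such that $x\mapsto\|f\chi_{Q+x}\|_{L_a^{p)}(\mathbb R^n)}$ belongs to $L^q(\mathbb R^n,\omega)$. Its norm is $\|f\|=\big\|\,\|f\chi_{Q+x}\|_{L_a^{p)}(\mathbb R^n)}\,\big\|_{L^q(\mathbb R^n,\omega)}$ (outer norm in the variable $x$). Boundedness of $M:X\to X$ means that there is $C>0$ with $Mf\in X$ and $\|Mf\|_X\le C\|f\|_X$ for all $f\in X$. *)

theory Defs
  imports "HOL-Analysis.Analysis"
begin

(* Power with exponent s > 0 on [0,\<infinity>], so \<infinity> is sent to \<infinity>. *)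
definition ennpow :: "ennreal \<Rightarrow> real \<Rightarrow> ennreal" where
  "ennpow t s = (if t = \<infinity> then \<infinity> else ennreal (enn2real t powr s))"

definition locally_integrable :: "('a::euclidean_space \<Rightarrow> real) \<Rightarrow> bool" where
  "locally_integrable w \<longleftrightarrow> (\<forall>K. compact K \<longrightarrow> set_integrable lebesgue K w)"

(* A weight is real valued and nonnegative, and may vanish only on a null set. *)
definition weight :: "('a::euclidean_space \<Rightarrow> real) \<Rightarrow> bool" where
  "weight w \<longleftrightarrow> w \<in> borel_measurable lebesgue \<and> locally_integrable w \<and>
     (\<forall>x. 0 \<le> w x) \<and> (AE x in lebesgue. 0 < w x)"

definition beurling_weight :: "('a::euclidean_space \<Rightarrow> real) \<Rightarrow> bool" where
  "beurling_weight a \<longleftrightarrow> weight a \<and> (\<forall>x y. a (x + y) \<le> a x * a y) \<and> (\<forall>x. 1 \<le> a x)"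

(* Function spaces are sets of functions rather than of a.e. classes; all norms and
   membership conditions below are invariant under a.e. equality.
   Norms take values in [0,\<infinity>]. *)

definition Lq_norm ::
  "real \<Rightarrow> ('a::euclidean_space \<Rightarrow> real) \<Rightarrow> ('a \<Rightarrow> 'b::real_normed_vector) \<Rightarrow> ennreal" where
  "Lq_norm q w f = ennpow (\<integral>\<^sup>+x. ennreal (norm (f x) powr q * w x) \<partial>lebesgue) (1 / q)"

definition Lq_space ::
  "real \<Rightarrow> ('a::euclidean_space \<Rightarrow> real) \<Rightarrow> ('a \<Rightarrow> 'b::real_normed_vector) set" where
  "Lq_space q w = {f \<in> borel_measurable lebesgue. Lq_norm q w f < \<infinity>}"

definition grand_norm ::
  "real \<Rightarrow> ('a::euclidean_space \<Rightarrow> real) \<Rightarrow> ('a \<Rightarrow> complex) \<Rightarrow> ennreal" where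
  "grand_norm p a f = (SUP \<epsilon>\<in>{0<..p - 1}. ennreal \<epsilon> *
     ennpow (\<integral>\<^sup>+x. ennreal (norm (f x) powr (p - \<epsilon>) * a x powr (\<epsilon> / p)) \<partial>lebesgue) (1 / (p - \<epsilon>)))"

definition grand_space ::
  "real \<Rightarrow> ('a::euclidean_space \<Rightarrow> real) \<Rightarrow> ('a \<Rightarrow> complex) set" where
  "grand_space p a = {f \<in> borel_measurable lebesgue. grand_norm p a f < \<infinity>}"

definition restr :: "'a set \<Rightarrow> ('a \<Rightarrow> complex) \<Rightarrow> 'a \<Rightarrow> complex" where
  "restr K f = (\<lambda>y. indicator K y * f y)"

(* The control function x \<mapsto> norm of f restricted to Q + x.  For f in the amalgam space
   the local norms are all finite (Q + x is compact), so enn2real loses nothing there. *)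
definition local_norm ::
  "'a set \<Rightarrow> real \<Rightarrow> ('a::euclidean_space \<Rightarrow> real) \<Rightarrow> ('a \<Rightarrow> complex) \<Rightarrow> 'a \<Rightarrow> real" where
  "local_norm Q p a f x = enn2real (grand_norm p a (restr ((\<lambda>y. y + x) ` Q) f))"

definition amalgam_space ::
  "'a set \<Rightarrow> real \<Rightarrow> ('a::euclidean_space \<Rightarrow> real) \<Rightarrow> real \<Rightarrow> ('a \<Rightarrow> real) \<Rightarrow> ('a \<Rightarrow> complex) set" where
  "amalgam_space Q p a q w = {f \<in> borel_measurable lebesgue.
     (\<forall>K. compact K \<longrightarrow> restr K f \<in> grand_space p a) \<and> local_norm Q p a f \<in> Lq_space q w}"

definition amalgam_norm ::
  "'a set \<Rightarrow> real \<Rightarrow> ('a::euclidean_space \<Rightarrow> real) \<Rightarrow> real \<Rightarrow> ('a \<Rightarrow> real) \<Rightarrow> ('a \<Rightarrow> complex) \<Rightarrow> ennreal" where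
  "amalgam_norm Q p a q w f = Lq_norm q w (local_norm Q p a f)"

definition maximal_fun :: "('a::euclidean_space \<Rightarrow> complex) \<Rightarrow> 'a \<Rightarrow> ennreal" where
  "maximal_fun f x = (SUP r\<in>{0<..}.
     (\<integral>\<^sup>+y\<in>ball x r. ennreal (norm (f y)) \<partial>lebesgue) / emeasure lebesgue (ball x r))"

(* The maximal function may be infinite; it represents an element of a space of (classes of)
   complex functions only if it is finite a.e., which is required separately because
   enn2real sends \<infinity> to 0. *)
definition maximal_bounded_on ::
  "('a::euclidean_space \<Rightarrow> complex) set \<Rightarrow> (('a \<Rightarrow> complex) \<Rightarrow> ennreal) \<Rightarrow> bool" where
  "maximal_bounded_on X N \<longleftrightarrow> (\<exists>C::real. C > 0 \<and> (\<forall>f\<in>X.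
     (AE x in lebesgue. maximal_fun f x < \<infinity>) \<and>
     (\<lambda>x. complex_of_real (enn2real (maximal_fun f x))) \<in> X \<and>
     N (\<lambda>x. complex_of_real (enn2real (maximal_fun f x))) \<le> ennreal C * N f))"

end

theory Submission
  imports Defs
begin

text \<open>
  By Hoelder's inequality the assumption on \<open>\<omega>\<close> embeds \<open>L\<^sup>q(\<omega>)\<close> into \<open>L\<^sup>1\<close>, so control
  functions of elements of the amalgam space are integrable. The indicator \<open>f\<close> of the unit ball
  belongs to the space, but \<open>M f(x) \<ge> (\<bar>x\<bar> + 1)\<^bsup>-n\<^esup>\<close>; since \<open>a \<ge> 1\<close>, taking \<open>\<epsilon> = p - 1\<close> bounds the
  control function of \<open>M f\<close> below by a multiple of \<open>(\<bar>x\<bar> + D)\<^bsup>-n\<^esup>\<close>, which is not integrable. Hence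
  \<open>M f\<close> is not even in the space.
\<close>

section \<open>Extended powers, the critical power of the norm, and a Hoelder-type embedding\<close>

lemma ennpow_less_top_iff: "ennpow t s < top \<longleftrightarrow> t < top"
  by (auto simp: ennpow_def less_top)

lemma measurable_ennpow [measurable]: "(\<lambda>t. ennpow t s) \<in> borel_measurable borel"
  unfolding ennpow_def by measurable

lemma ennpow_1: "ennpow t 1 = t"
  by (cases t) (auto simp: ennpow_def)

lemma ennpow_ennreal: "0 \<le> t \<Longrightarrow> ennpow (ennreal t) s = ennreal (t powr s)"
  by (simp add: ennpow_def)

text \<open>The exponent is critical: the integrand decays like the reciprocal of the volume of a
  ball, so every scale contributes about the same mass. If the integral were finite, its tails over
  \<open>norm x \<ge> k\<close> would tend to 0 by dominated convergence, whereas each tail with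
  \<open>k \<ge> D\<close> is at least a fixed positive constant.\<close>

lemma nn_integral_inverse_norm_power_eq_top:
  fixes D :: real
  assumes "0 < D"
  shows "(\<integral>\<^sup>+x. ennreal (1 / (norm (x :: 'a::euclidean_space) + D) ^ DIM('a)) \<partial>lebesgue) = \<infinity>"
proof (rule ccontr)
  let ?u = "\<lambda>x::'a. ennreal (1 / (norm x + D) ^ DIM('a))"
  let ?v = "unit_ball_vol (real DIM('a))"
  assume *: "(\<integral>\<^sup>+x. ?u x \<partial>lebesgue) \<noteq> \<infinity>"
  have vpos: "?v > 0" by simp
  have lower: "ennreal (?v / 4 ^ DIM('a)) \<le>
      (\<integral>\<^sup>+x. ?u x * indicator {x. R \<le> norm x} x \<partial>lebesgue)" if R: "D \<le> R" for R
  proof -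
    obtain e :: 'a where e: "norm e = 1"
      using vector_choose_size[of 1] by auto
    \<comment> \<open>A centre at distance 2R and a radius R place the ball in the shell between R
      and 3R. There \<open>norm x + D\<close> is at most 4R because \<open>D \<le> R\<close>, and
      the volume is \<open>?v * R ^ DIM('a)\<close>, so R cancels and the constant
      \<open>?v / 4 ^ DIM('a)\<close> remains.\<close>
    let ?B = "ball ((2 * R) *\<^sub>R e) R"
    have R0: "R > 0" using R assms by linarith
    have B: "R \<le> norm x" "norm x \<le> 3 * R" if "x \<in> ?B" for x
    proof -
      have "norm ((2 * R) *\<^sub>R e) = 2 * R" using R0 e by simp
      moreover have "norm ((2 * R) *\<^sub>R e - x) < R" using that by (simp add: dist_norm)
      ultimately show "R \<le> norm x" "norm x \<le> 3 * R"
        using norm_triangle_ineq2[of "(2 * R) *\<^sub>R e" x] norm_triangle_ineq2[of x "(2 * R) *\<^sub>R e"]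
        by (auto simp: norm_minus_commute)
    qed
    have "ennreal (?v / 4 ^ DIM('a)) = ennreal (1 / (4 * R) ^ DIM('a)) * emeasure lebesgue ?B"
      using R0 by (simp add: emeasure_ball ennreal_mult[symmetric] power_mult_distrib)
    also have "\<dots> = (\<integral>\<^sup>+x. ennreal (1 / (4 * R) ^ DIM('a)) * indicator ?B x \<partial>lebesgue)"
      by (simp add: nn_integral_cmult_indicator)
    also have "\<dots> \<le> (\<integral>\<^sup>+x. ?u x * indicator {x. R \<le> norm x} x \<partial>lebesgue)"
    proof (rule nn_integral_mono)
      fix x :: 'a
      show "ennreal (1 / (4 * R) ^ DIM('a)) * indicator ?B x \<le> ?u x * indicator {x. R \<le> norm x} x"
      proof (cases "x \<in> ?B")
        case True
        have "norm x + D > 0" using assms by (simp add: add_nonneg_pos)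
        then have "1 / (4 * R) ^ DIM('a) \<le> 1 / (norm x + D) ^ DIM('a)"
          using B[OF True] R by (intro divide_left_mono power_mono mult_pos_pos zero_less_power) (auto simp: R0)
        then show ?thesis using True B[OF True] by (auto intro!: ennreal_leI)
      qed auto
    qed
    finally show ?thesis .
  qed
  have "(\<lambda>k. \<integral>\<^sup>+x. ?u x * indicator {x. real k \<le> norm x} x \<partial>lebesgue)
      \<longlonglongrightarrow> (\<integral>\<^sup>+x. 0 \<partial>(lebesgue :: 'a measure))"
  proof (rule nn_integral_dominated_convergence[where w = ?u])
    show "AE x in lebesgue. (\<lambda>k. ?u x * indicator {x. real k \<le> norm x} x) \<longlonglongrightarrow> 0"
    proof (rule AE_I2)
      fix x :: 'a
      have "eventually (\<lambda>k. real k > norm x) sequentially"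
        using filterlim_real_sequentially by (simp add: filterlim_at_top_dense)
      then have "eventually (\<lambda>k. ?u x * indicator {x. real k \<le> norm x} x = 0) sequentially"
        by eventually_elim auto
      then show "(\<lambda>k. ?u x * indicator {x. real k \<le> norm x} x) \<longlonglongrightarrow> 0"
        by (rule tendsto_eventually)
    qed
    show "(\<integral>\<^sup>+x. ?u x \<partial>lebesgue) < \<infinity>" using * by (simp add: less_top)
  qed (auto intro!: measurable_completion simp: indicator_def)
  then have lim: "(\<lambda>k. \<integral>\<^sup>+x. ?u x * indicator {x. real k \<le> norm x} x \<partial>lebesgue) \<longlonglongrightarrow> 0"
    by simp
  have "ennreal (?v / 4 ^ DIM('a)) \<le> 0"
  \<comment> \<open>The index starts at the ceiling of D because the lower bound holds only for
    radii at least D.\<close>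
  proof (rule Lim_bounded2[OF lim, of "nat \<lceil>D\<rceil>"], intro allI impI)
    fix k :: nat assume "nat \<lceil>D\<rceil> \<le> k"
    then have "D \<le> real k" by linarith
    then show "ennreal (?v / 4 ^ DIM('a)) \<le>
      (\<integral>\<^sup>+x. ?u x * indicator {x. real k \<le> norm x} x \<partial>lebesgue)" by (rule lower)
  qed
  then show False using vpos by (simp add: ennreal_eq_0_iff field_simps)
qed

text \<open>Only finiteness is wanted, so a pointwise estimate replaces the full Hoelder inequality.
  With X = |u|^q w and Y = w^(-r/q) one has |u| = X^(1/q) Y^(1/r). Both factors grow when X and Y
  are replaced by X + Y, and the exponents add up to 1, so |u| is at most X + Y, whose integral is
  finite.\<close>

lemma Lq_norm_finite_imp_nn_integral_finite:
  fixes u w :: "'a::euclidean_space \<Rightarrow> real"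
  assumes q: "1 < q" and qr: "1 / q + 1 / r = 1"
    and w: "w \<in> borel_measurable lebesgue" "AE x in lebesgue. 0 < w x"
    and dual: "Lq_norm r (\<lambda>x. 1) (\<lambda>x. w x powr (- 1 / q)) < \<infinity>"
    and u: "u \<in> borel_measurable lebesgue" "Lq_norm q w u < \<infinity>"
  shows "(\<integral>\<^sup>+x. ennreal \<bar>u x\<bar> \<partial>lebesgue) < \<infinity>"
proof -
  have r: "1 < r"
  proof -
    have "0 < 1 / q" "1 / q < 1" using q by auto
    then have "0 < 1 / r" "1 / r < 1" using qr by linarith+
    then show ?thesis by (simp add: zero_less_divide_iff)
  qed
  let ?F = "\<lambda>x. ennreal (norm (u x) powr q * w x)"
  let ?G = "\<lambda>x. ennreal (norm (w x powr (- 1 / q)) powr r * 1)"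
  have "(\<integral>\<^sup>+x. ennreal \<bar>u x\<bar> \<partial>lebesgue) \<le> (\<integral>\<^sup>+x. ?F x + ?G x \<partial>lebesgue)"
  proof (rule nn_integral_mono_AE, use w(2) in eventually_elim)
    fix x assume wx: "0 < w x"
    let ?X = "\<bar>u x\<bar> powr q * w x" and ?Y = "(w x powr (- 1 / q)) powr r"
    have "\<bar>u x\<bar> = (\<bar>u x\<bar> * w x powr (1 / q)) * w x powr (- 1 / q)"
      using wx by (simp add: powr_minus field_simps)
    also have "\<dots> = ?X powr (1 / q) * ?Y powr (1 / r)"
      using q r wx by (simp add: powr_mult powr_powr)
    also have "\<dots> \<le> (?X + ?Y) powr (1 / q) * (?X + ?Y) powr (1 / r)"
      using q r wx by (intro mult_mono powr_mono2) auto
    also have "\<dots> = ?X + ?Y"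
      using wx by (simp add: powr_add[symmetric] qr)
    finally show "ennreal \<bar>u x\<bar> \<le> ?F x + ?G x"
      using wx by (simp add: ennreal_plus[symmetric] ennreal_leI del: ennreal_plus)
  qed
  also have "\<dots> = (\<integral>\<^sup>+x. ?F x \<partial>lebesgue) + (\<integral>\<^sup>+x. ?G x \<partial>lebesgue)"
    using u(1) w(1) by (intro nn_integral_add) (measurable; simp)+
  also have "\<dots> < \<infinity>"
    using u(2) dual by (simp add: Lq_norm_def ennpow_less_top_iff)
  finally show ?thesis .
qed

section \<open>Grand norms of indicators: bounds and measurability under translation\<close>

lemma grand_norm_indicator:
  "grand_norm p a (indicator S) = (SUP \<epsilon>\<in>{0<..p - 1}. ennreal \<epsilon> *
     ennpow (\<integral>\<^sup>+x\<in>S. ennreal (a x powr (\<epsilon> / p)) \<partial>lebesgue) (1 / (p - \<epsilon>)))"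
  unfolding grand_norm_def
  by (intro SUP_cong refl arg_cong2[where f = "(*)"] arg_cong2[where f = ennpow] nn_integral_cong)
     (auto simp: indicator_def)

context
  fixes p :: real and a :: "'a::euclidean_space \<Rightarrow> real"
  assumes p: "1 < p" and a_ge: "\<And>x. 1 \<le> a x" and a_meas [measurable]: "a \<in> borel_measurable lebesgue"
begin

text \<open>Makes \<open>a\<close> itself a common majorant for the weights of all \<epsilon>; it
  serves both the uniform bounds and dominated convergence.\<close>

lemma powr_le_self: "0 < \<epsilon> \<Longrightarrow> \<epsilon> \<le> p - 1 \<Longrightarrow> a x powr (\<epsilon> / p) \<le> a x"
  using powr_mono[of "\<epsilon> / p" 1 "a x"] a_ge[of x] p by (simp add: divide_le_eq)

lemma grand_norm_indicator_le:
  assumes "(\<integral>\<^sup>+x\<in>S. ennreal (a x) \<partial>lebesgue) \<le> ennreal A" "0 \<le> A"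
  shows "grand_norm p a (indicator S) \<le> ennreal ((p - 1) * (1 + A))"
  unfolding grand_norm_indicator
proof (rule SUP_least)
  fix \<epsilon> assume \<epsilon>: "\<epsilon> \<in> {0<..p - 1}"
  let ?I = "\<integral>\<^sup>+x\<in>S. ennreal (a x powr (\<epsilon> / p)) \<partial>lebesgue"
  have "?I \<le> (\<integral>\<^sup>+x\<in>S. ennreal (a x) \<partial>lebesgue)"
    using \<epsilon> powr_le_self by (intro nn_integral_mono mult_right_mono ennreal_leI) auto
  also note assms(1)
  finally have "?I \<le> ennreal A" .
  then obtain i where i: "?I = ennreal i" "0 \<le> i" "i \<le> A"
    using assms(2) by (cases ?I) (auto simp: top_unique)
  \<comment> \<open>The exponent lies in (0,1] because \<open>p - \<epsilon> \<ge> 1\<close>.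
    Enlarging the base to \<open>1 + A\<close>, which is at least 1, allows the exponent to be
    raised to 1 and yields a bound independent of \<epsilon>.\<close>
  have "i powr (1 / (p - \<epsilon>)) \<le> (1 + A) powr (1 / (p - \<epsilon>))"
    using \<epsilon> i by (intro powr_mono2) auto
  also have "\<dots> \<le> (1 + A) powr 1"
    using \<epsilon> assms(2) by (intro powr_mono) (auto simp: divide_le_eq)
  finally have "\<epsilon> * i powr (1 / (p - \<epsilon>)) \<le> (p - 1) * (1 + A)"
    using \<epsilon> assms(2) p by (intro mult_mono) auto
  then show "ennreal \<epsilon> * ennpow ?I (1 / (p - \<epsilon>)) \<le> ennreal ((p - 1) * (1 + A))"
    using \<epsilon> i by (auto simp: ennpow_ennreal ennreal_mult[symmetric] intro!: ennreal_leI)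
qed

text \<open>Continuity in \<open>\<epsilon>\<close> reduces the supremum to a countable one, which is what makes the
  control function of the amalgam norm measurable.\<close>

lemma grand_norm_indicator_rational:
  assumes [measurable]: "S \<in> sets lebesgue" and fin: "(\<integral>\<^sup>+x\<in>S. ennreal (a x) \<partial>lebesgue) < \<infinity>"
  shows "grand_norm p a (indicator S) = (SUP \<epsilon>\<in>{0<..p - 1} \<inter> \<rat>. ennreal \<epsilon> *
     ennpow (\<integral>\<^sup>+x\<in>S. ennreal (a x powr (\<epsilon> / p)) \<partial>lebesgue) (1 / (p - \<epsilon>)))"
    (is "_ = ?R")
proof (rule antisym)
  let ?I = "\<lambda>\<epsilon>. \<integral>\<^sup>+x\<in>S. ennreal (a x powr (\<epsilon> / p)) \<partial>lebesgue"
  let ?F = "\<lambda>\<epsilon>. ennreal \<epsilon> * ennpow (?I \<epsilon>) (1 / (p - \<epsilon>))"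
  have I_fin: "?I \<epsilon> < \<infinity>" if "\<epsilon> \<in> {0<..p - 1}" for \<epsilon>
  proof -
    have "?I \<epsilon> \<le> (\<integral>\<^sup>+x\<in>S. ennreal (a x) \<partial>lebesgue)"
      using that powr_le_self by (intro nn_integral_mono mult_right_mono ennreal_leI) auto
    then show ?thesis using fin by (rule le_less_trans)
  qed
  show "grand_norm p a (indicator S) \<le> ?R"
    unfolding grand_norm_indicator
  proof (rule SUP_least)
    fix \<epsilon> assume \<epsilon>: "\<epsilon> \<in> {0<..p - 1}"
    \<comment> \<open>The rationals approach \<epsilon> strictly from below, so they stay in the
      index range even at the endpoint \<open>\<epsilon> = p - 1\<close>; the maximum with 0 keeps
      them positive.\<close>
    have "\<exists>d\<in>\<rat>. max 0 (\<epsilon> - 1 / real (Suc k)) < d \<and> d < \<epsilon>" for k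
      using Rats_dense_in_real[of "max 0 (\<epsilon> - 1 / real (Suc k))" \<epsilon>] \<epsilon> by auto
    then obtain d where d: "\<And>k. d k \<in> \<rat>" "\<And>k. max 0 (\<epsilon> - 1 / real (Suc k)) < d k" "\<And>k. d k < \<epsilon>"
      by metis
    have d_lim: "d \<longlonglongrightarrow> \<epsilon>"
    proof (rule tendsto_sandwich)
      have "(\<lambda>k. \<epsilon> - 1 / real (Suc k)) \<longlonglongrightarrow> \<epsilon> - 0"
        by (intro tendsto_diff tendsto_const LIMSEQ_Suc[OF lim_1_over_n])
      then show "(\<lambda>k. \<epsilon> - 1 / real (Suc k)) \<longlonglongrightarrow> \<epsilon>" by simp
      show "\<forall>\<^sub>F k in sequentially. \<epsilon> - 1 / real (Suc k) \<le> d k"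
        using d(2) by (intro always_eventually allI less_imp_le) (meson max.strict_boundedE)
      show "\<forall>\<^sub>F k in sequentially. d k \<le> \<epsilon>"
        using d(3) by (intro always_eventually allI less_imp_le)
    qed simp
    have d_in: "d k \<in> {0<..p - 1} \<inter> \<rat>" for k
      using d(1)[of k] d(2)[of k] d(3)[of k] \<epsilon> by auto
    have I_lim: "(\<lambda>k. ?I (d k)) \<longlonglongrightarrow> ?I \<epsilon>"
    proof (rule nn_integral_dominated_convergence[where w = "\<lambda>x. ennreal (a x) * indicator S x"])
      show "AE x in lebesgue. ennreal (a x powr (d k / p)) * indicator S x
          \<le> ennreal (a x) * indicator S x" for k
        using d_in[of k] powr_le_self by (intro AE_I2 mult_right_mono ennreal_leI) auto
      show "AE x in lebesgue. (\<lambda>k. ennreal (a x powr (d k / p)) * indicator S x)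
          \<longlonglongrightarrow> ennreal (a x powr (\<epsilon> / p)) * indicator S x"
      proof (rule AE_I2)
        fix x
        have "(\<lambda>k. a x powr (d k / p)) \<longlonglongrightarrow> a x powr (\<epsilon> / p)"
          using a_ge[of x] p by (intro tendsto_powr tendsto_const tendsto_divide d_lim) auto
        then show "(\<lambda>k. ennreal (a x powr (d k / p)) * indicator S x)
            \<longlonglongrightarrow> ennreal (a x powr (\<epsilon> / p)) * indicator S x"
          by (cases "x \<in> S") (auto intro: tendsto_ennrealI)
      qed
    qed (use fin in \<open>measurable; simp\<close>)+
    let ?i = "\<lambda>\<epsilon>. enn2real (?I \<epsilon>)"
    have I_eq: "?I \<delta> = ennreal (?i \<delta>)" if "\<delta> \<in> {0<..p - 1}" for \<delta>
      using I_fin[OF that] by (simp add: less_top)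
    have F_eq: "?F \<delta> = ennreal (\<delta> * ?i \<delta> powr (1 / (p - \<delta>)))" if "\<delta> \<in> {0<..p - 1}" for \<delta>
      by (subst I_eq[OF that], subst ennpow_ennreal) (use that in \<open>auto simp: ennreal_mult\<close>)
    have i_lim: "(\<lambda>k. ?i (d k)) \<longlonglongrightarrow> ?i \<epsilon>"
      using I_lim I_fin[OF \<epsilon>] by (auto intro!: tendsto_enn2real simp: less_top)
    \<comment> \<open>The base may tend to 0, for instance when \<open>S\<close> is a null set.
      Continuity of the power survives there because the bases are nonnegative and the limit
      exponent is positive.\<close>
    have "(\<lambda>k. d k * ?i (d k) powr (1 / (p - d k))) \<longlonglongrightarrow> \<epsilon> * ?i \<epsilon> powr (1 / (p - \<epsilon>))"
      using \<epsilon> d(3)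
      by (intro tendsto_mult tendsto_powr' i_lim d_lim tendsto_divide tendsto_diff tendsto_const)
         auto
    then have "(\<lambda>k. ?F (d k)) \<longlonglongrightarrow> ?F \<epsilon>"
      using d_in F_eq \<epsilon> by (simp add: tendsto_ennrealI)
    then show "?F \<epsilon> \<le> ?R"
      using d_in by (intro Lim_bounded[where M = 0]) (auto intro!: SUP_upper)
  qed
  show "?R \<le> grand_norm p a (indicator S)"
    unfolding grand_norm_indicator by (rule SUP_subset_mono) auto
qed

text \<open>For fixed \<epsilon> the integral over the translate is of convolution type, with kernel
  \<open>indicator Q (y - x)\<close>, and so depends measurably on x by Tonelli. The supremum over
  rational \<epsilon> is countable and preserves this.\<close>

lemma measurable_grand_norm_translate:
  assumes Q: "compact Q" and B: "B \<in> sets lebesgue"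
    and fin: "(\<integral>\<^sup>+x\<in>B. ennreal (a x) \<partial>lebesgue) < \<infinity>"
  shows "(\<lambda>x. grand_norm p a (indicator ((\<lambda>y. y + x) ` Q \<inter> B))) \<in> borel_measurable lebesgue"
proof -
  let ?S = "\<lambda>x. (\<lambda>y. y + x) ` Q \<inter> B"
  have shift: "y \<in> (\<lambda>y. y + x) ` Q \<longleftrightarrow> y - x \<in> Q" for x y
    by (auto simp: image_iff algebra_simps intro: bexI[of _ "y - x"])
  have Qx: "compact ((\<lambda>y. y + x) ` Q)" for x
    using Q by (intro compact_continuous_image continuous_intros)
  have S: "?S x \<in> sets lebesgue" for x
    using Qx[of x] B by (intro sets.Int) (auto intro: lmeasurable_compact[THEN fmeasurableD])
  have S_fin: "(\<integral>\<^sup>+y\<in>?S x. ennreal (a y) \<partial>lebesgue) < \<infinity>" for x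
  proof (rule le_less_trans[OF _ fin])
    show "(\<integral>\<^sup>+y\<in>?S x. ennreal (a y) \<partial>lebesgue) \<le> (\<integral>\<^sup>+y\<in>B. ennreal (a y) \<partial>lebesgue)"
      by (intro nn_integral_mono mult_left_mono) (auto simp: indicator_def)
  qed
  have I: "(\<lambda>x. \<integral>\<^sup>+y\<in>?S x. ennreal (a y powr (\<epsilon> / p)) \<partial>lebesgue) \<in> borel_measurable lebesgue" for \<epsilon>
  proof -
    let ?h = "\<lambda>y. ennreal (a y powr (\<epsilon> / p)) * indicator B y"
    have "?h \<in> borel_measurable lebesgue" using B by measurable
    \<comment> \<open>Tonelli needs joint measurability in x and y for the product of Borel
      structures, so the Lebesgue measurable integrand is replaced by a Borel version. The
      exceptional null set does not depend on x, hence the integrals agree for every x.\<close>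
    then obtain h where h [measurable]: "h \<in> borel_measurable lborel" and hh: "AE y in lborel. ?h y = h y"
      using completion_ex_borel_measurable[of ?h lborel] by blast
    have [measurable]: "Q \<in> sets borel" using Q by (intro borel_closed compact_imp_closed)
    have "(\<integral>\<^sup>+y\<in>?S x. ennreal (a y powr (\<epsilon> / p)) \<partial>lebesgue)
        = (\<integral>\<^sup>+y. indicator Q (y - x) * h y \<partial>lborel)" for x
    proof -
      have "(\<integral>\<^sup>+y\<in>?S x. ennreal (a y powr (\<epsilon> / p)) \<partial>lebesgue)
          = (\<integral>\<^sup>+y. indicator Q (y - x) * h y \<partial>lebesgue)"
        using AE_completion[OF hh]
        by (intro nn_integral_cong_AE, elim eventually_mono) (auto simp: indicator_def shift)
      then show ?thesis by (simp add: nn_integral_completion)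
    qed
    moreover have "(\<lambda>x. \<integral>\<^sup>+y. indicator Q (y - x) * h y \<partial>lborel) \<in> borel_measurable lborel"
      by (rule lborel.borel_measurable_nn_integral) measurable
    ultimately show ?thesis by (simp add: measurable_completion)
  qed
  show ?thesis
    unfolding grand_norm_indicator_rational[OF S S_fin]
    by (intro borel_measurable_SUP borel_measurable_times_ennreal borel_measurable_const
        measurable_compose[OF I measurable_ennpow])
       (auto intro: countable_subset[OF _ countable_rat])
qed

end

section \<open>Indicators of bounded sets as elements of the amalgam space\<close>

lemma restr_indicator: "restr K (indicator B) = indicator (K \<inter> B)"
  by (auto simp: restr_def indicator_def fun_eq_iff)

lemma nn_integral_weight_bounded_finite:
  assumes "weight w" "bounded B"
  shows "(\<integral>\<^sup>+x\<in>B. ennreal (w x) \<partial>lebesgue) < \<infinity>"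
proof -
  have "compact (closure B)" using assms(2) by (simp add: compact_closure)
  then have int: "set_integrable lebesgue (closure B) w"
    using assms(1) by (simp add: weight_def locally_integrable_def)
  have "(\<integral>\<^sup>+x\<in>B. ennreal (w x) \<partial>lebesgue)
      \<le> (\<integral>\<^sup>+x. ennreal (norm (indicator (closure B) x *\<^sub>R w x)) \<partial>lebesgue)"
    using closure_subset by (intro nn_integral_mono) (auto simp: indicator_def ennreal_leI)
  also have "\<dots> < \<infinity>"
    using int by (simp add: set_integrable_def integrable_iff_bounded)
  finally show ?thesis .
qed

text \<open>The local norms are bounded by one constant, since \<open>a\<close> has finite integral
  over \<open>B\<close>, and they vanish unless \<open>Q + x\<close> meets \<open>B\<close>. The
  control function is thus bounded with bounded support, and local integrability of \<open>w\<close>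
  puts it into the outer space.\<close>

lemma indicator_in_amalgam_space:
  fixes a w :: "'a::euclidean_space \<Rightarrow> real"
  assumes p: "1 < p" and q: "1 < q" and a: "beurling_weight a" and w: "weight w"
    and Q: "compact Q" and B: "B \<in> sets lebesgue" "bounded B"
  shows "indicator B \<in> amalgam_space Q p a q w"
proof -
  have a_ge: "1 \<le> a x" for x using a by (simp add: beurling_weight_def)
  have a_w: "weight a" using a by (simp add: beurling_weight_def)
  have a_meas: "a \<in> borel_measurable lebesgue" using a_w by (simp add: weight_def)
  note fin = nn_integral_weight_bounded_finite[OF a_w B(2)]
  obtain A where A: "(\<integral>\<^sup>+x\<in>B. ennreal (a x) \<partial>lebesgue) = ennreal A" "0 \<le> A"
    using fin by (cases "\<integral>\<^sup>+x\<in>B. ennreal (a x) \<partial>lebesgue") auto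
  define c where "c = (p - 1) * (1 + A)"
  have c: "0 \<le> c" using p A by (simp add: c_def)
  have bound: "grand_norm p a (indicator (K \<inter> B)) \<le> ennreal c" for K
    unfolding c_def
  proof (rule grand_norm_indicator_le[OF p a_ge a_meas _ A(2)])
    show "(\<integral>\<^sup>+x\<in>K \<inter> B. ennreal (a x) \<partial>lebesgue) \<le> ennreal A"
      unfolding A(1)[symmetric] by (intro nn_integral_mono mult_left_mono) (auto simp: indicator_def)
  qed
  define N where "N = local_norm Q p a (indicator B)"
  have N_eq: "N x = enn2real (grand_norm p a (indicator ((\<lambda>y. y + x) ` Q \<inter> B)))" for x
    by (simp add: N_def local_norm_def restr_indicator)
  have N_meas: "N \<in> borel_measurable lebesgue"
    using measurable_grand_norm_translate[OF p a_ge a_meas Q B(1) fin]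
    unfolding N_eq[abs_def] by measurable
  have N_bd: "0 \<le> N x" "N x \<le> c" for x
    using bound c by (auto simp: N_eq enn2real_leI)
  obtain R where R: "\<And>x. x \<in> Q \<Longrightarrow> norm x \<le> R" using Q compact_imp_bounded bounded_iff by metis
  obtain T where T: "\<And>x. x \<in> B \<Longrightarrow> norm x \<le> T" using B(2) bounded_iff by metis
  have N_0: "N x = 0" if "x \<notin> cball 0 (R + T)" for x
  proof -
    have "(\<lambda>y. y + x) ` Q \<inter> B = {}"
    proof (rule ccontr)
      assume "(\<lambda>y. y + x) ` Q \<inter> B \<noteq> {}"
      then obtain y where y: "y \<in> Q" "y + x \<in> B" by auto
      have "norm x \<le> norm (y + x) + norm y"
        using norm_triangle_ineq4[of "y + x" y] by simp
      then show False using R[OF y(1)] T[OF y(2)] that by auto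
    qed
    \<comment> \<open>The integral over the empty set is 0, and \<open>ennpow\<close> sends 0 to 0
      because \<open>0 powr s = 0\<close>.\<close>
    then show ?thesis
      using p by (simp add: N_eq grand_norm_indicator ennpow_def)
  qed
  have "(\<integral>\<^sup>+x. ennreal (norm (N x) powr q * w x) \<partial>lebesgue)
      \<le> (\<integral>\<^sup>+x. ennreal (c powr q) * (ennreal (w x) * indicator (cball 0 (R + T)) x) \<partial>lebesgue)"
  proof (rule nn_integral_mono)
    fix x
    have wx: "0 \<le> w x" using w by (simp add: weight_def)
    show "ennreal (norm (N x) powr q * w x)
      \<le> ennreal (c powr q) * (ennreal (w x) * indicator (cball 0 (R + T)) x)"
    proof (cases "x \<in> cball 0 (R + T)")
      case True
      have "norm (N x) powr q * w x \<le> c powr q * w x"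
        using N_bd[of x] q wx by (intro mult_right_mono powr_mono2) auto
      then show ?thesis using True wx by (simp add: ennreal_mult[symmetric] ennreal_leI)
    qed (simp add: N_0)
  qed
  also have "\<dots> = ennreal (c powr q) * (\<integral>\<^sup>+x\<in>cball 0 (R + T). ennreal (w x) \<partial>lebesgue)"
    using w by (intro nn_integral_cmult borel_measurable_times_ennreal borel_measurable_indicator)
      (auto simp: weight_def)
  also have "\<dots> < \<infinity>"
    using nn_integral_weight_bounded_finite[OF w bounded_cball[of 0 "R + T"]]
    by (auto simp: ennreal_mult_less_top)
  finally have "N \<in> Lq_space q w"
    using N_meas by (simp add: Lq_space_def Lq_norm_def ennpow_less_top_iff)
  moreover have "restr K (indicator B) \<in> grand_space p a" if "compact K" for K
  proof -
    have "K \<inter> B \<in> sets lebesgue"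
      using that B(1) by (intro sets.Int) (auto intro: lmeasurable_compact[THEN fmeasurableD])
    then show ?thesis
      using le_less_trans[OF bound[of K]]
      by (simp add: grand_space_def restr_indicator borel_measurable_indicator)
  qed
  ultimately show ?thesis
    using B(1) by (simp add: amalgam_space_def N_def borel_measurable_indicator)
qed

section \<open>Lower bounds for the maximal function and for control functions\<close>

lemma maximal_fun_indicator_ball_ge:
  "ennreal (1 / (norm x + 1) ^ DIM('a)) \<le> maximal_fun (indicator (ball 0 1)) (x :: 'a::euclidean_space)"
proof -
  \<comment> \<open>This is the smallest radius for which the open ball around x contains the unit
    ball; the average over it is a ratio of volumes in which \<open>?v\<close> cancels.\<close>
  let ?r = "norm x + 1" and ?v = "unit_ball_vol (real DIM('a))"
  have r: "?r > 0" by (simp add: add_nonneg_pos)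
  have v: "?v > 0" by simp
  have sub: "y \<in> ball x ?r" if "y \<in> ball 0 1" for y
    using that norm_triangle_ineq4[of x y] by (simp add: dist_norm)
  have "(\<integral>\<^sup>+y\<in>ball x ?r. ennreal (norm (indicator (ball 0 1) y :: complex)) \<partial>lebesgue)
      = (\<integral>\<^sup>+y. indicator (ball (0::'a) 1) y \<partial>lebesgue)"
    by (intro nn_integral_cong) (use sub in \<open>auto simp: indicator_def\<close>)
  also have "\<dots> = ennreal ?v" by (simp add: emeasure_ball)
  finally have "(\<integral>\<^sup>+y\<in>ball x ?r. ennreal (norm (indicator (ball 0 1) y :: complex)) \<partial>lebesgue)
      / emeasure lebesgue (ball x ?r) = ennreal ?v / ennreal (?v * ?r ^ DIM('a))"
    using r by (simp add: emeasure_ball)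
  also have "\<dots> = ennreal (1 / ?r ^ DIM('a))"
    using r v by (subst divide_ennreal) (auto simp: less_imp_neq[OF v, symmetric])
  finally have "ennreal (1 / ?r ^ DIM('a)) =
      (\<integral>\<^sup>+y\<in>ball x ?r. ennreal (norm (indicator (ball 0 1) y :: complex)) \<partial>lebesgue)
      / emeasure lebesgue (ball x ?r)" ..
  also have "\<dots> \<le> maximal_fun (indicator (ball 0 1)) x"
    unfolding maximal_fun_def using r by (intro SUP_upper) auto
  finally show ?thesis .
qed

text \<open>A single term of the supremum suffices: at \<open>\<epsilon> = p - 1\<close> the
  exponent of |g| and the outer root are both 1, so the term is a multiple of a weighted integral of
  |g|. The weight is at least 1, and the decay bound on g changes little across
  \<open>Q + x\<close>.\<close>

lemma local_norm_ge:
  fixes g :: "'a::euclidean_space \<Rightarrow> complex"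
  assumes p: "1 < p" and a: "\<And>x. 1 \<le> a x" and Q: "compact Q" and R: "Q \<subseteq> cball 0 R" "0 \<le> R"
    and g: "AE y in lebesgue. 1 / (norm y + 1) ^ DIM('a) \<le> norm (g y)"
    and fin: "\<And>K. compact K \<Longrightarrow> grand_norm p a (restr K g) < \<infinity>"
  shows "(p - 1) * measure lebesgue Q * (1 / (norm x + (R + 1)) ^ DIM('a)) \<le> local_norm Q p a g x"
proof -
  let ?K = "(\<lambda>y. y + x) ` Q" and ?t = "1 / (norm x + (R + 1)) ^ DIM('a)"
  have K: "compact ?K" using Q by (intro compact_continuous_image continuous_intros)
  have K_meas: "?K \<in> sets lebesgue" using K by (auto intro: lmeasurable_compact[THEN fmeasurableD])
  have "measure lebesgue ?K = measure lebesgue Q"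
    using measure_translation[of x Q] by (simp add: add.commute)
  then have K_em: "emeasure lebesgue ?K = ennreal (measure lebesgue Q)"
    using emeasure_eq_measure2[OF lmeasurable_compact[OF K]] by simp
  have "ennreal ((p - 1) * measure lebesgue Q * ?t) = ennreal (p - 1) * (ennreal ?t * emeasure lebesgue ?K)"
    using p R by (simp add: K_em ennreal_mult[symmetric] mult_ac)
  also have "\<dots> = ennreal (p - 1) * (\<integral>\<^sup>+y. ennreal ?t * indicator ?K y \<partial>lebesgue)"
    using K_meas by (simp add: nn_integral_cmult_indicator)
  also have "\<dots> \<le> ennreal (p - 1) *
      (\<integral>\<^sup>+y. ennreal (norm (restr ?K g y) powr (p - (p - 1)) * a y powr ((p - 1) / p)) \<partial>lebesgue)"
  proof (intro mult_left_mono nn_integral_mono_AE, use g in eventually_elim)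
    fix y assume y: "1 / (norm y + 1) ^ DIM('a) \<le> norm (g y)"
    show "ennreal ?t * indicator ?K y
      \<le> ennreal (norm (restr ?K g y) powr (p - (p - 1)) * a y powr ((p - 1) / p))"
    proof (cases "y \<in> ?K")
      case True
      then obtain z where z: "z \<in> Q" "y = z + x" by auto
      \<comment> \<open>Hence \<open>norm y + 1\<close> is at most \<open>norm x + (R + 1)\<close>,
        which is where the shift in \<open>?t\<close> comes from.\<close>
      have "norm y \<le> norm x + R"
        using z R(1) norm_triangle_ineq[of z x] by auto
      then have "?t \<le> 1 / (norm y + 1) ^ DIM('a)"
        using R(2) by (intro divide_left_mono power_mono mult_pos_pos zero_less_power)
          (auto simp: add_nonneg_pos)
      also note y
      also have "norm (g y) \<le> norm (g y) * a y powr ((p - 1) / p)"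
        using a[of y] p by (simp add: mult_le_cancel_left1 ge_one_powr_ge_zero)
      finally show ?thesis using True by (auto simp: restr_def intro!: ennreal_leI)
    qed auto
  qed auto
  also have "\<dots> = ennreal (p - 1) * ennpow
      (\<integral>\<^sup>+y. ennreal (norm (restr ?K g y) powr (p - (p - 1)) * a y powr ((p - 1) / p)) \<partial>lebesgue)
      (1 / (p - (p - 1)))"
    by (simp add: ennpow_1)
  also have "\<dots> \<le> grand_norm p a (restr ?K g)"
    unfolding grand_norm_def
    by (rule SUP_upper[where i = "p - 1" and A = "{0<..p - 1}"]) (use p in auto)
  \<comment> \<open>Finiteness of the grand norm is essential here: \<open>enn2real\<close> would
    send an infinite value to 0 and destroy the lower bound.\<close>
  finally have "enn2real (ennreal ((p - 1) * measure lebesgue Q * ?t)) \<le> local_norm Q p a g x"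
    unfolding local_norm_def using fin[OF K] by (intro enn2real_mono) auto
  then show ?thesis using p R by simp
qed

theorem proposition4p2:
  fixes p q r :: real
    and a \<omega> :: "real ^ 'n \<Rightarrow> real"
    and Q :: "(real ^ 'n) set"
  assumes "1 < p" and "1 < q"
    and "weight a" and "weight \<omega>"
    and "beurling_weight a"
    and "1 / q + 1 / r = 1"
    and "(\<lambda>x. \<omega> x powr (- 1 / q)) \<in> Lq_space r (\<lambda>x. 1)"
    and "compact Q" and "interior Q \<noteq> {}"
  shows "\<not> maximal_bounded_on (amalgam_space Q p a q \<omega>) (amalgam_norm Q p a q \<omega>)"
proof
  let ?f = "indicator (ball 0 1) :: real ^ 'n \<Rightarrow> complex"
  define g where "g = (\<lambda>x. complex_of_real (enn2real (maximal_fun ?f x)))"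
  assume "maximal_bounded_on (amalgam_space Q p a q \<omega>) (amalgam_norm Q p a q \<omega>)"
  moreover have "?f \<in> amalgam_space Q p a q \<omega>"
    using assms by (intro indicator_in_amalgam_space) auto
  ultimately have AE_fin: "AE x in lebesgue. maximal_fun ?f x < \<infinity>"
    and g_in: "g \<in> amalgam_space Q p a q \<omega>"
    unfolding maximal_bounded_on_def g_def by blast+
  obtain R where R: "Q \<subseteq> cball 0 R" "0 \<le> R"
    using bounded_subset_ballD[OF compact_imp_bounded[OF \<open>compact Q\<close>], of 0] ball_subset_cball
    by (metis less_imp_le order_trans)
  \<comment> \<open>The bound passes from \<open>maximal_fun\<close> to \<open>g\<close> only where
    the former is finite, because \<open>enn2real\<close> maps infinity to 0.\<close>
  have "AE y in lebesgue. 1 / (norm y + 1) ^ DIM(real ^ 'n) \<le> norm (g y)"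
    using AE_fin
  proof eventually_elim
    fix y assume "maximal_fun ?f y < \<infinity>"
    then have "enn2real (ennreal (1 / (norm y + 1) ^ DIM(real ^ 'n))) \<le> enn2real (maximal_fun ?f y)"
      by (intro enn2real_mono maximal_fun_indicator_ball_ge) auto
    then show "1 / (norm y + 1) ^ DIM(real ^ 'n) \<le> norm (g y)"
      by (simp add: g_def)
  qed
  then have lower: "(p - 1) * measure lebesgue Q * (1 / (norm x + (R + 1)) ^ DIM(real ^ 'n))
      \<le> local_norm Q p a g x" for x
    using assms R g_in
    by (intro local_norm_ge) (auto simp: beurling_weight_def amalgam_space_def grand_space_def)
  \<comment> \<open>Nonempty interior makes the constant in \<open>lower\<close> strictly positive;
    otherwise that bound would be vacuous.\<close>
  have Q_pos: "0 < measure lebesgue Q"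
  proof -
    have "\<not> negligible Q"
      using \<open>interior Q \<noteq> {}\<close> negligible_subset[OF _ interior_subset] open_not_negligible open_interior
      by blast
    then show ?thesis
      using lmeasurable_compact[OF \<open>compact Q\<close>]
      by (simp add: negligible_iff_measure zero_less_measure_iff)
  qed
  define c where "c = (p - 1) * measure lebesgue Q"
  have c: "0 < c" using assms(1) Q_pos by (simp add: c_def)
  \<comment> \<open>Membership of \<open>g\<close> alone gives this finite integral, so the norm
    inequality in the boundedness assumption is never reached. The chain that follows bounds the
    same integral below by infinity.\<close>
  have "(\<integral>\<^sup>+x. ennreal \<bar>local_norm Q p a g x\<bar> \<partial>lebesgue) < \<infinity>"
    using assms g_in
    by (intro Lq_norm_finite_imp_nn_integral_finite[where q = q and r = r and w = \<omega>])
       (auto simp: weight_def Lq_space_def amalgam_space_def)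
  moreover have "\<infinity> = ennreal c *
      (\<integral>\<^sup>+x. ennreal (1 / (norm (x :: real ^ 'n) + (R + 1)) ^ DIM(real ^ 'n)) \<partial>lebesgue)"
    using c R nn_integral_inverse_norm_power_eq_top[of "R + 1", where 'a = "real ^ 'n"]
    by (simp add: ennreal_mult_top)
  moreover have "\<dots> = (\<integral>\<^sup>+x. ennreal c *
      ennreal (1 / (norm (x :: real ^ 'n) + (R + 1)) ^ DIM(real ^ 'n)) \<partial>lebesgue)"
    by (intro nn_integral_cmult[symmetric]) (auto intro!: measurable_completion)
  moreover have "\<dots> \<le> (\<integral>\<^sup>+x. ennreal \<bar>local_norm Q p a g x\<bar> \<partial>lebesgue)"
  proof (rule nn_integral_mono)
    fix x :: "real ^ 'n"
    show "ennreal c * ennreal (1 / (norm x + (R + 1)) ^ DIM(real ^ 'n)) \<le> ennreal \<bar>local_norm Q p a g x\<bar>"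
      using lower[of x] c R by (auto simp: ennreal_mult[symmetric] c_def intro!: ennreal_leI)
  qed
  ultimately show False by simp
qed

end
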